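(* Let $(G,+)$ be a countable abelian group and let $(X,\mathcal A,\mu,(T_g)_{g\in G})$ be a measure preserving system. For $\epsilon>0$ and $A_0,A_1\in\mathcal A$ let $R_\epsilon(A_0,A_1)=\{g\in G : |\mu(A_0\cap T_gA_1)-\mu(A_0)\mu(A_1)|<\epsilon\}$. The following statements are equivalent: (i) $(T_g)_{g\in G}$ is strongly mixing. (ii) For any $m\in\mathbb N$, any $\epsilon>0$ and any $A_0,A_1\in\mathcal A$, the set $R_\epsilon(A_0,A_1)$ is $\Sigma_m^*$ in $G$. (iii) There exists an $m\in\mathbb N$ such that for any $\epsilon>0$ and any $A_0,A_1\in\mathcal A$, the set $R_\epsilon(A_0,A_1)$ is $\Sigma_m^*$ in $G$.
   Context: $\mathbb N=\{1,2,\dots\}$. A measure preserving system $(X,\mathcal A,\mu,(T_g)_{g\in G})$ consists of a separable probability space and an action of the countable discrete abelian group $G$ on it by (invertible) $\mu$-preserving transformations; as a standing assumption the space is regular, i.e. $X$ is a compact metric space and $\mathcal A=\mathrm{Borel}(X)$. For a sequence in $G$, $\lim_{k\to\infty}g_k=\infty$ means that for every finite $F\subseteq G$, $g_k\notin F$ for all large $k$. The system is strongly mixing if $\lim_{g\to\infty}\mu(A_0\cap T_gA_1)=\mu(A_0)\mu(A_1)$ for all $A_0,A_1\in\mathcal A$. A set $E\subseteq G$ is a $\Sigma_m$ set if $E=\{g^{(1)}_{k_1}+\cdots+g^{(m)}_{k_m} : k_1<\cdots<k_m\}$ (with $k_1,\dots,k_m\in\mathbb N$), where for each $j\in\{1,\dots,m\}$,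 $(g^{(j)}_k)_{k\in\mathbb N}$ is a sequence in $G$ with $\lim_{k\to\infty}g^{(j)}_k=\infty$. A subset of $G$ is $\Sigma_m^*$ if it has non-empty intersection with every $\Sigma_m$ set. *)

theory Defs
  imports "HOL-Probability.Probability"
begin

text \<open>
  The group \<open>G\<close> is the type \<open>'g\<close>; the topological space \<open>X\<close> is \<open>space M\<close>, a compact subset of a
  metric space with its relative Borel sets. Compactness makes the probability space separable,
  so separability is not assumed. Invertibility of each \<open>T g\<close> on \<open>space M\<close> is a consequence of
  the action laws.
\<close>

locale measure_preserving_system = prob_space M
  for M :: "'x::metric_space measure" +
  fixes T :: "'g::{ab_group_add, countable} \<Rightarrow> 'x \<Rightarrow> 'x"
  assumes compact_space: "compact (space M)"
    and sets_eq_borel: "sets M = sets (restrict_space borel (space M))"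
    and measurable_T: "T g \<in> measurable M M"
    and measure_preserving_T: "distr M M (T g) = M"
    and action_zero: "x \<in> space M \<Longrightarrow> T 0 x = x"
    and action_add: "x \<in> space M \<Longrightarrow> T (g + h) x = T g (T h x)"

text \<open>
  The limit \<open>g \<rightarrow> \<infinity>\<close> in the discrete group \<open>G\<close> is the filter \<^const>\<open>cofinite\<close>: for a sequence,
  \<open>filterlim s cofinite sequentially\<close> says that \<open>s\<close> eventually leaves every finite set.
\<close>

definition strongly_mixing ::
    "'x measure \<Rightarrow> ('g \<Rightarrow> 'x \<Rightarrow> 'x) \<Rightarrow> bool" where
  "strongly_mixing M T \<longleftrightarrow>
    (\<forall>A0\<in>sets M. \<forall>A1\<in>sets M.
      ((\<lambda>g. measure M (A0 \<inter> T g ` A1)) \<longlongrightarrow> measure M A0 * measure M A1) cofinite)"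

definition Sigma_set :: "nat \<Rightarrow> 'g::ab_group_add set \<Rightarrow> bool" where
  "Sigma_set m E \<longleftrightarrow>
    (\<exists>s :: nat \<Rightarrow> nat \<Rightarrow> 'g.
      (\<forall>j\<in>{1..m}. filterlim (s j) cofinite sequentially) \<and>
      E = {\<Sum>j=1..m. s j (k j) | k :: nat \<Rightarrow> nat.
            (\<forall>j\<in>{1..m}. 1 \<le> k j) \<and> strict_mono_on {1..m} k})"

definition Sigma_star_set :: "nat \<Rightarrow> 'g::ab_group_add set \<Rightarrow> bool" where
  "Sigma_star_set m S \<longleftrightarrow> (\<forall>E. Sigma_set m E \<longrightarrow> S \<inter> E \<noteq> {})"

definition return_set ::
    "'x measure \<Rightarrow> ('g \<Rightarrow> 'x \<Rightarrow> 'x) \<Rightarrow> real \<Rightarrow> 'x set \<Rightarrow> 'x set \<Rightarrow> 'g set" where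
  "return_set M T \<epsilon> A0 A1 =
    {g. \<bar>measure M (A0 \<inter> T g ` A1) - measure M A0 * measure M A1\<bar> < \<epsilon>}"

end

theory Submission
  imports Defs "HOL-Library.Ramsey"
begin

text \<open>
  The set \<open>R\<^sub>\<epsilon>(A\<^sub>0, A\<^sub>1)\<close> is cofinite for all data exactly when \<open>T\<close> is strongly mixing, and a set
  is cofinite exactly when it is \<open>\<Sigma>\<^sub>1\<^sup>*\<close>. Fixing the first index of a \<open>\<Sigma>\<^sub>m\<^sub>+\<^sub>1\<close> set leaves a
  \<open>\<Sigma>\<^sub>m\<close> set inside it, so the \<open>\<Sigma>\<^sub>m\<^sup>*\<close> conditions become weaker as \<open>m\<close> grows. It remains to
  recover the condition for \<open>m = 1\<close> from the condition for one large \<open>m\<close>, and since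
  \<open>m \<le> 2\<^sup>m\<close> it is enough to descend from \<open>2n\<close> to \<open>n\<close>.

  This descent is a van der Corput argument. Suppose that \<open>A\<^sub>0\<close> has covariance at least \<open>\<epsilon>\<close> in
  absolute value with \<open>T\<^sub>b A\<^sub>1\<close> for all \<open>b\<close> in a \<open>\<Sigma>\<^sub>n\<close> set. Events that are all correlated with
  one event cannot be almost pairwise uncorrelated: by Cauchy-Schwarz, among infinitely many of
  them two have covariance at least \<open>\<epsilon>\<^sup>2/2\<close> (\<open>correlated_pair\<close>). Taking for these events
  \<open>T\<^sub>b A\<^sub>1\<close>, with \<open>b\<close> running over sums along consecutive blocks of \<open>n\<close> indices, gives
  blocks \<open>K < L\<close> such that \<open>A\<^sub>1\<close> is correlated with \<open>T\<^sub>g A\<^sub>1\<close> for \<open>g = b\<^sub>L - b\<^sub>K\<close>. As \<open>G\<close> is abelian,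
  \<open>g\<close> is a sum of \<open>2n\<close> terms with increasing indices, the first \<open>n\<close> of them from the negated
  sequences. Ramsey's theorem for \<open>2n\<close>-subsets of the indices makes this happen for all
  \<open>K < L\<close> at once after passing to a subsequence; thus \<open>R\<^sub>\<delta>(A\<^sub>1, A\<^sub>1)\<close> with
  \<open>\<delta> = \<epsilon>\<^sup>2/2\<close> misses a \<open>\<Sigma>\<^sub>2\<^sub>n\<close> set (\<open>Sigma_star_halve\<close>).
\<close>

section \<open>\<open>\<Sigma>\<^sub>m\<^sup>*\<close> sets for different \<open>m\<close>\<close>

lemma filterlim_cofinite_inj_comp:
  fixes h :: "'b \<Rightarrow> 'c"
  assumes "filterlim s cofinite F" "inj h"
  shows "filterlim (\<lambda>x. h (s x)) cofinite F"
proof -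
  have "filterlim h cofinite cofinite"
    unfolding filterlim_iff eventually_cofinite
  proof (intro allI impI)
    fix P :: "'c \<Rightarrow> bool" assume "finite {x. \<not> P x}"
    then show "finite {x. \<not> P (h x)}"
      using finite_vimageI[OF _ \<open>inj h\<close>, of "{x. \<not> P x}"] by (simp add: vimage_def)
  qed
  then show ?thesis
    using filterlim_compose assms(1) by blast
qed

lemma strict_mono_filterlim_sequentially_comp:
  fixes \<phi> :: "nat \<Rightarrow> nat"
  assumes "filterlim s F sequentially" "strict_mono \<phi>"
  shows "filterlim (\<lambda>i. s (\<phi> i)) F sequentially"
  using filterlim_compose[OF assms(1) filterlim_subseq[OF assms(2)]] .

lemma Sigma_set_Suc_contains_Sigma_set:
  assumes "Sigma_set (Suc n) E" "n \<ge> 1"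
  obtains E' where "Sigma_set n E'" "E' \<subseteq> E"
proof -
  obtain s where s: "\<And>j. j \<in> {1..Suc n} \<Longrightarrow> filterlim (s j) cofinite sequentially"
    and E: "E = {\<Sum>j=1..Suc n. s j (k j) | k :: nat \<Rightarrow> nat.
            (\<forall>j\<in>{1..Suc n}. 1 \<le> k j) \<and> strict_mono_on {1..Suc n} k}"
    using assms(1) unfolding Sigma_set_def by blast
  \<comment> \<open>The first index is fixed to be 1, the constant \<open>s 1 1\<close> is absorbed into the new first
    sequence, and the other indices are shifted so that they stay above 1.\<close>
  define c where "c j = (if j = 1 then s 1 1 else 0)" for j :: nat
  define s' where "s' j i = c j + s (Suc j) (Suc i)" for j i
  let ?E = "{\<Sum>j=1..n. s' j (k j) | k :: nat \<Rightarrow> nat.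
            (\<forall>j\<in>{1..n}. 1 \<le> k j) \<and> strict_mono_on {1..n} k}"
  have "filterlim (s' j) cofinite sequentially" if "j \<in> {1..n}" for j
  proof -
    have "filterlim (\<lambda>i. s (Suc j) (Suc i)) cofinite sequentially"
      using s[of "Suc j"] that
      by (simp add: strict_mono_filterlim_sequentially_comp strict_mono_def)
    then show ?thesis
      unfolding s'_def by (rule filterlim_cofinite_inj_comp) (auto simp: inj_def)
  qed
  then have "Sigma_set n ?E"
    unfolding Sigma_set_def by blast
  moreover have "?E \<subseteq> E"
  proof
    fix x assume "x \<in> ?E"
    then obtain k where x: "x = (\<Sum>j=1..n. s' j (k j))"
      and k1: "\<And>j. j \<in> {1..n} \<Longrightarrow> 1 \<le> k j" and k: "strict_mono_on {1..n} k"
      by blast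
    define k' where "k' j = (if j = 1 then 1 else Suc (k (j - 1)))" for j
    have "x = (\<Sum>j=1..n. c j) + (\<Sum>j=1..n. s (Suc j) (Suc (k j)))"
      unfolding x s'_def by (simp add: sum.distrib)
    also have "(\<Sum>j=1..n. c j) = s 1 1"
      using assms(2) by (simp add: c_def)
    also have "(\<Sum>j=1..n. s (Suc j) (Suc (k j))) = (\<Sum>j=1..n. s (Suc j) (k' (Suc j)))"
      by (intro sum.cong) (auto simp: k'_def)
    also have "\<dots> = (\<Sum>j=Suc 1..Suc n. s j (k' j))"
      by (simp only: sum.atLeast_Suc_atMost_Suc_shift o_def)
    also have "s 1 1 + \<dots> = (\<Sum>j=1..Suc n. s j (k' j))"
      by (subst (2) sum.atLeast_Suc_atMost) (auto simp: k'_def)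
    finally have "x = (\<Sum>j=1..Suc n. s j (k' j))" .
    moreover have "strict_mono_on {1..Suc n} k'"
    proof (rule strict_mono_onI)
      fix a b assume ab: "a \<in> {1..Suc n}" "b \<in> {1..Suc n}" "a < b"
      show "k' a < k' b"
      proof (cases "a = 1")
        case True
        then have "1 \<le> k (b - 1)"
          using ab by (intro k1) auto
        then show ?thesis
          using True ab by (simp add: k'_def)
      next
        case False
        then have "k (a - 1) < k (b - 1)"
          using ab by (intro strict_mono_onD[OF k]) auto
        then show ?thesis
          using ab False by (auto simp: k'_def)
      qed
    qed
    moreover have "\<forall>j\<in>{1..Suc n}. 1 \<le> k' j"
      by (auto simp: k'_def)
    ultimately show "x \<in> E"
      unfolding E by blast
  qed
  ultimately show thesis
    using that by blast
qed

lemma Sigma_star_set_mono: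
  assumes "Sigma_star_set n S" "1 \<le> n" "n \<le> m"
  shows "Sigma_star_set m S"
  using assms(3)
proof (induction m rule: dec_induct)
  case base
  show ?case by (fact assms(1))
next
  case (step m)
  show ?case
    unfolding Sigma_star_set_def
  proof (intro allI impI)
    fix E :: "'a set" assume "Sigma_set (Suc m) E"
    then obtain E' where "Sigma_set m E'" "E' \<subseteq> E"
      using step.hyps assms(2) Sigma_set_Suc_contains_Sigma_set[of m E] by auto
    then show "S \<inter> E \<noteq> {}"
      using step.IH unfolding Sigma_star_set_def by blast
  qed
qed

lemma Sigma_set_1_iff:
  "Sigma_set 1 E \<longleftrightarrow>
    (\<exists>s :: nat \<Rightarrow> 'g::ab_group_add. filterlim s cofinite sequentially \<and> E = s ` {1..})"
proof -
  have eq: "{\<Sum>j=1..1. s j (k j) | k :: nat \<Rightarrow> nat.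
      (\<forall>j\<in>{1..1}. 1 \<le> k j) \<and> strict_mono_on {1..1} k} = s 1 ` {1..}"
    for s :: "nat \<Rightarrow> nat \<Rightarrow> 'g"
  proof (intro equalityI subsetI)
    fix x assume "x \<in> s 1 ` {1..}"
    then obtain i where "x = s 1 i" "i \<ge> 1" by auto
    then show "x \<in> {\<Sum>j=1..1. s j (k j) | k :: nat \<Rightarrow> nat.
      (\<forall>j\<in>{1..1}. 1 \<le> k j) \<and> strict_mono_on {1..1} k}"
      by (intro CollectI exI[of _ "\<lambda>_. i"]) (auto intro: strict_mono_onI)
  qed auto
  show ?thesis
    unfolding Sigma_set_def eq
  proof
    assume "\<exists>s :: nat \<Rightarrow> 'g. filterlim s cofinite sequentially \<and> E = s ` {1..}"
    then obtain s :: "nat \<Rightarrow> 'g" where "filterlim s cofinite sequentially \<and> E = s ` {1..}" ..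
    then show "\<exists>s. (\<forall>j\<in>{1..1}. filterlim (s j) cofinite sequentially) \<and> E = s 1 ` {1..}"
      by (intro exI[of _ "\<lambda>_. s"]) auto
  qed auto
qed

lemma Sigma_star_set_1_iff_finite_Compl:
  fixes S :: "'g::ab_group_add set"
  shows "Sigma_star_set 1 S \<longleftrightarrow> finite (- S)"
proof
  assume S: "Sigma_star_set 1 S"
  show "finite (- S)"
  proof (rule ccontr)
    assume "infinite (- S)"
    then obtain s :: "nat \<Rightarrow> 'g" where s: "inj s" "range s \<subseteq> - S"
      using infinite_countable_subset by blast
    have "filterlim s cofinite sequentially"
      using filterlim_cofinite_inj_comp[OF filterlim_ident s(1)]
      by (simp add: cofinite_eq_sequentially)
    then have "Sigma_set 1 (s ` {1..})"
      unfolding Sigma_set_1_iff by blast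
    then show False
      using S s(2) unfolding Sigma_star_set_def by blast
  qed
next
  assume fin: "finite (- S)"
  show "Sigma_star_set 1 S"
    unfolding Sigma_star_set_def Sigma_set_1_iff
  proof (intro allI impI, elim exE conjE)
    fix E and s :: "nat \<Rightarrow> 'g"
    assume s: "filterlim s cofinite sequentially" and E: "E = s ` {1..}"
    have "eventually (\<lambda>g. g \<in> S) cofinite"
      using fin by (simp add: eventually_cofinite Compl_eq)
    then have "eventually (\<lambda>i. s i \<in> S) sequentially"
      using s by (rule eventually_compose_filterlim)
    then obtain i where "i \<ge> 1" "s i \<in> S"
      unfolding eventually_sequentially by (meson nat_le_linear)
    then show "S \<inter> E \<noteq> {}"
      unfolding E by auto
  qed
qed

lemma strongly_mixing_iff_Sigma_star_set_1:
  fixes T :: "'g::ab_group_add \<Rightarrow> 'x \<Rightarrow> 'x"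
  shows "strongly_mixing M T \<longleftrightarrow>
    (\<forall>\<epsilon>>0. \<forall>A0\<in>sets M. \<forall>A1\<in>sets M. Sigma_star_set 1 (return_set M T \<epsilon> A0 A1))"
  unfolding strongly_mixing_def Sigma_star_set_1_iff_finite_Compl tendsto_iff eventually_cofinite
    return_set_def Compl_eq dist_real_def mem_Collect_eq
  by blast

section \<open>Ramsey's theorem along subsequences\<close>

lemma sorted_list_of_image_strict_mono_on:
  fixes k :: "nat \<Rightarrow> nat"
  assumes "strict_mono_on {1..r} k"
  shows "sorted_list_of_set (k ` {1..r}) = map k [1..<Suc r]"
proof -
  have "sorted_wrt (<) (map k [1..<Suc r])"
    unfolding sorted_wrt_map
    by (rule sorted_wrt_mono_rel[OF _ sorted_wrt_upt])
      (auto intro: strict_mono_onD[OF assms] simp del: upt_Suc)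
  moreover have "set (map k [1..<Suc r]) = k ` {1..r}"
    by (simp add: atLeastLessThanSuc_atLeastAtMost del: upt_Suc)
  ultimately show ?thesis
    by (metis sorted_list_of_set.idem_if_sorted_distinct strict_sorted_iff)
qed

text \<open>
  An increasing \<open>r\<close>-tuple is determined by its range, so that a property of such tuples is a
  colouring of the \<open>r\<close>-element sets. Enumerating a homogeneous set turns Ramsey's theorem into
  a statement about subsequences, the form needed for conditions on \<open>\<Sigma>\<^sub>r\<close> sets.
\<close>

lemma Ramsey_subseq:
  fixes Q :: "(nat \<Rightarrow> nat) \<Rightarrow> bool"
  assumes cong: "\<And>k k'. (\<And>j. j \<in> {1..r} \<Longrightarrow> k j = k' j) \<Longrightarrow> Q k = Q k'"
  obtains \<phi> :: "nat \<Rightarrow> nat" where "strict_mono \<phi>"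
    "(\<forall>k. strict_mono_on {1..r} k \<longrightarrow> Q (\<phi> \<circ> k)) \<or>
     (\<forall>k. strict_mono_on {1..r} k \<longrightarrow> \<not> Q (\<phi> \<circ> k))"
proof -
  define f :: "nat set \<Rightarrow> nat"
    where "f X = of_bool (Q (\<lambda>j. sorted_list_of_set X ! (j - 1)))" for X
  have f_image: "f (k ` {1..r}) = of_bool (Q k)" if "strict_mono_on {1..r} k" for k
  proof -
    have "Q (\<lambda>j. sorted_list_of_set (k ` {1..r}) ! (j - 1)) = Q k"
      unfolding sorted_list_of_image_strict_mono_on[OF that]
      by (rule cong) (auto simp: nth_append simp del: upt_Suc)
    then show ?thesis
      by (simp add: f_def)
  qed
  obtain Y t where Y: "infinite Y"
    and hom: "\<And>X. X \<subseteq> Y \<Longrightarrow> finite X \<Longrightarrow> card X = r \<Longrightarrow> f X = t"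
    using Ramsey[of "UNIV :: nat set" r f 2] unfolding f_def of_bool_def by fastforce
  define \<phi> where "\<phi> = enumerate Y"
  have \<phi>: "strict_mono \<phi>"
    using Y by (simp add: \<phi>_def strict_mono_enumerate)
  have "of_bool (Q (\<phi> \<circ> k)) = t" if k: "strict_mono_on {1..r} k" for k
  proof -
    have mono: "strict_mono_on {1..r} (\<phi> \<circ> k)"
      using strict_monoD[OF \<phi>] strict_mono_onD[OF k] by (auto intro!: strict_mono_onI)
    have "(\<phi> \<circ> k) ` {1..r} \<subseteq> Y"
      using Y by (auto simp: \<phi>_def enumerate_in_set)
    moreover have "card ((\<phi> \<circ> k) ` {1..r}) = r"
      using card_image[OF strict_mono_on_imp_inj_on[OF mono]] by simp
    ultimately show ?thesis
      using hom[of "(\<phi> \<circ> k) ` {1..r}"] f_image[OF mono] by simp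
  qed
  then have "(\<forall>k. strict_mono_on {1..r} k \<longrightarrow> Q (\<phi> \<circ> k)) \<or>
      (\<forall>k. strict_mono_on {1..r} k \<longrightarrow> \<not> Q (\<phi> \<circ> k))"
    by (metis of_bool_eq_iff)
  with \<phi> show thesis by (rule that)
qed

section \<open>Covariance of events\<close>

context prob_space
begin

definition event_cov :: "'a set \<Rightarrow> 'a set \<Rightarrow> real" where
  "event_cov A B = prob (A \<inter> B) - prob A * prob B"

definition centred :: "'a set \<Rightarrow> 'a \<Rightarrow> real" where
  "centred A x = indicator A x - prob A"

lemma abs_event_cov_le_1: "\<bar>event_cov A B\<bar> \<le> 1"
proof -
  have "0 \<le> prob A * prob B" "prob A * prob B \<le> 1"
    using mult_mono[of "prob A" 1 "prob B" 1] by auto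
  then show ?thesis
    unfolding event_cov_def
    using prob_le_1[of "A \<inter> B"] measure_nonneg[of M "A \<inter> B"] by linarith
qed

lemma
  assumes [measurable]: "A \<in> events" "B \<in> events"
  shows integrable_centred_mult: "integrable M (\<lambda>x. centred A x * centred B x)"
    and expectation_centred_mult: "expectation (\<lambda>x. centred A x * centred B x) = event_cov A B"
proof -
  have eq: "centred A x * centred B x = indicator (A \<inter> B) x - prob B * indicator A x
      - prob A * indicator B x + prob A * prob B" for x
    by (simp add: centred_def indicator_inter_arith algebra_simps)
  show "integrable M (\<lambda>x. centred A x * centred B x)"
    unfolding eq by (simp add: less_top[symmetric])
  show "expectation (\<lambda>x. centred A x * centred B x) = event_cov A B"
    unfolding eq by (simp add: less_top[symmetric] event_cov_def prob_space)
qed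

text \<open>
  This is Cauchy-Schwarz for the centred indicator of \<open>A\<close>, whose norm is at most 1, and the
  combination of the centred indicators of the \<open>B i\<close> with the signs of their covariances with
  \<open>A\<close>. The signs disappear on passing to absolute values.
\<close>

lemma sum_abs_event_cov_squared_le:
  assumes A: "A \<in> events" and I: "finite I" and B: "\<And>i. i \<in> I \<Longrightarrow> B i \<in> events"
  shows "(\<Sum>i\<in>I. \<bar>event_cov A (B i)\<bar>)\<^sup>2 \<le> (\<Sum>i\<in>I. \<Sum>j\<in>I. \<bar>event_cov (B i) (B j)\<bar>)"
proof -
  define a where "a = (\<Sum>i\<in>I. \<bar>event_cov A (B i)\<bar>)"
  define \<sigma> where "\<sigma> i = sgn (event_cov A (B i))" for i
  define Y where "Y x = (\<Sum>i\<in>I. \<sigma> i * centred (B i) x)" for x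
  let ?q = "\<Sum>i\<in>I. \<Sum>j\<in>I. (\<sigma> i * \<sigma> j) * event_cov (B i) (B j)"
  have YY: "(Y x)\<^sup>2 = (\<Sum>i\<in>I. \<Sum>j\<in>I. (\<sigma> i * \<sigma> j) * (centred (B i) x * centred (B j) x))" for x
    unfolding Y_def power2_eq_square sum_product by (simp add: mult_ac)
  have AY: "centred A x * Y x = (\<Sum>i\<in>I. \<sigma> i * (centred A x * centred (B i) x))" for x
    unfolding Y_def sum_distrib_left by (simp add: mult_ac)
  have int: "integrable M (\<lambda>x. (Y x)\<^sup>2)" "integrable M (\<lambda>x. centred A x * Y x)"
      "integrable M (\<lambda>x. centred A x * centred A x)"
    unfolding YY AY using A B
    by (auto intro!: Bochner_Integration.integrable_sum integrable_centred_mult)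
  have "expectation (\<lambda>x. (Y x)\<^sup>2) = ?q"
    unfolding YY using B
    by (simp add: Bochner_Integration.integral_sum integrable_centred_mult
        expectation_centred_mult)
  moreover have "expectation (\<lambda>x. centred A x * Y x) = a"
  proof -
    have "expectation (\<lambda>x. centred A x * Y x) = (\<Sum>i\<in>I. \<sigma> i * event_cov A (B i))"
      unfolding AY using A B
      by (subst Bochner_Integration.integral_sum)
        (auto intro!: integrable_centred_mult sum.cong simp: expectation_centred_mult)
    then show ?thesis
      by (simp add: a_def \<sigma>_def abs_sgn mult.commute)
  qed
  \<comment> \<open>As \<open>a\<close> is the inner product of \<open>Y\<close> with the centred indicator of \<open>A\<close>, expanding this
    square gives Cauchy-Schwarz.\<close>
  moreover have "expectation (\<lambda>x. (Y x - a * centred A x)\<^sup>2) =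
      expectation (\<lambda>x. (Y x)\<^sup>2) - 2 * a * expectation (\<lambda>x. centred A x * Y x)
      + a\<^sup>2 * expectation (\<lambda>x. centred A x * centred A x)"
  proof -
    have eq: "(Y x - a * centred A x)\<^sup>2 =
        (Y x)\<^sup>2 - (2 * a) * (centred A x * Y x) + a\<^sup>2 * (centred A x * centred A x)" for x
      by (simp add: power2_eq_square algebra_simps)
    show ?thesis
      unfolding eq using int by simp
  qed
  moreover have "0 \<le> expectation (\<lambda>x. (Y x - a * centred A x)\<^sup>2)"
    by simp
  ultimately have "0 \<le> ?q - 2 * a * a + a\<^sup>2 * event_cov A A"
    using A by (simp add: expectation_centred_mult)
  moreover have "a\<^sup>2 * event_cov A A \<le> a\<^sup>2"
    using abs_event_cov_le_1[of A A] by (intro mult_left_le) auto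
  ultimately have "a\<^sup>2 \<le> ?q"
    by (simp add: power2_eq_square)
  also have "\<dots> \<le> (\<Sum>i\<in>I. \<Sum>j\<in>I. \<bar>event_cov (B i) (B j)\<bar>)"
  proof (intro sum_mono)
    fix i j
    have "\<bar>\<sigma> i * \<sigma> j\<bar> \<le> 1"
      by (simp add: \<sigma>_def abs_mult sgn_real_def)
    then have "\<bar>\<sigma> i * \<sigma> j\<bar> * \<bar>event_cov (B i) (B j)\<bar> \<le> \<bar>event_cov (B i) (B j)\<bar>"
      by (intro mult_left_le_one_le) auto
    then show "(\<sigma> i * \<sigma> j) * event_cov (B i) (B j) \<le> \<bar>event_cov (B i) (B j)\<bar>"
      using abs_ge_self[of "(\<sigma> i * \<sigma> j) * event_cov (B i) (B j)"] by (simp only: abs_mult)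
  qed
  finally show ?thesis
    by (simp add: a_def)
qed

text \<open>
  If all pairs had covariance below \<open>\<epsilon>\<^sup>2/2\<close>, the first \<open>N\<close> events would give
  \<open>(N \<epsilon>)\<^sup>2 \<le> N + N\<^sup>2 \<epsilon>\<^sup>2/2\<close> by the preceding inequality, which fails for large \<open>N\<close>.
\<close>

lemma correlated_pair:
  fixes B :: "nat \<Rightarrow> 'a set"
  assumes A: "A \<in> events" and B: "\<And>i. B i \<in> events" and "\<epsilon> > 0"
    and cor: "\<And>i. \<epsilon> \<le> \<bar>event_cov A (B i)\<bar>"
  shows "\<exists>i j. i < j \<and> \<epsilon>\<^sup>2 / 2 \<le> \<bar>event_cov (B i) (B j)\<bar>"
proof (rule ccontr)
  assume "\<not> ?thesis"
  then have less: "\<bar>event_cov (B i) (B j)\<bar> < \<epsilon>\<^sup>2 / 2" if "i < j" for i j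
    using that by (meson not_less)
  have entry: "\<bar>event_cov (B i) (B j)\<bar> \<le> of_bool (i = j) + \<epsilon>\<^sup>2 / 2" for i j
  proof (cases i j rule: linorder_cases)
    case greater
    then show ?thesis
      using less[of j i] by (simp add: event_cov_def Int_commute mult.commute)
  next
    case equal
    then show ?thesis
      using abs_event_cov_le_1[of "B i" "B j"] by (simp add: add_increasing2)
  qed (use less[of i j] in simp)
  obtain N :: nat where N: "2 / \<epsilon>\<^sup>2 < N"
    using reals_Archimedean2 by blast
  then have "0 < real N"
    using \<open>\<epsilon> > 0\<close> by (smt (verit) divide_nonneg_nonneg zero_le_power2)
  have "(N * \<epsilon>)\<^sup>2 \<le> (\<Sum>i<N. \<bar>event_cov A (B i)\<bar>)\<^sup>2"
    using \<open>\<epsilon> > 0\<close> sum_bounded_below[of "{..<N}" \<epsilon> "\<lambda>i. \<bar>event_cov A (B i)\<bar>"] cor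
    by (intro power_mono) auto
  also have "\<dots> \<le> (\<Sum>i<N. \<Sum>j<N. \<bar>event_cov (B i) (B j)\<bar>)"
    by (rule sum_abs_event_cov_squared_le) (auto simp: A B)
  also have "\<dots> \<le> (\<Sum>i<N. \<Sum>j<N. of_bool (i = j) + \<epsilon>\<^sup>2 / 2)"
    by (intro sum_mono entry)
  also have "\<dots> = N + N\<^sup>2 * (\<epsilon>\<^sup>2 / 2)"
    by (simp add: sum.distrib of_bool_def power2_eq_square algebra_simps)
  finally have "N * (N * \<epsilon>\<^sup>2) \<le> N * 2"
    by (simp add: power2_eq_square algebra_simps)
  then have "N * \<epsilon>\<^sup>2 \<le> 2"
    using \<open>0 < real N\<close> by simp
  then show False
    using N \<open>\<epsilon> > 0\<close> by (simp add: field_simps)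
qed

end

section \<open>Covariances along the action\<close>

context measure_preserving_system
begin

lemma T_in_space: "x \<in> space M \<Longrightarrow> T g x \<in> space M"
  using measurable_T[of g] by (simp add: measurable_space)

lemma T_uminus_T: "x \<in> space M \<Longrightarrow> T (- g) (T g x) = x"
  using action_add[of x "- g" g] action_zero by simp

lemma T_T_uminus: "x \<in> space M \<Longrightarrow> T g (T (- g) x) = x"
  using T_uminus_T[of x "- g"] by simp

lemma image_T_eq_vimage:
  assumes "A \<in> events"
  shows "T g ` A = T (- g) -` A \<inter> space M"
proof -
  have sub: "A \<subseteq> space M"
    using assms by (rule sets.sets_into_space)
  show ?thesis
  proof (intro equalityI subsetI)
    fix y assume "y \<in> T (- g) -` A \<inter> space M"
    then show "y \<in> T g ` A"
      using T_T_uminus[of y g] by (metis IntE image_eqI vimageE)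
  qed (use sub T_in_space T_uminus_T in auto)
qed

lemma image_T_in_events: "A \<in> events \<Longrightarrow> T g ` A \<in> events"
  using measurable_sets[OF measurable_T] by (simp add: image_T_eq_vimage)

lemma prob_image_T: "A \<in> events \<Longrightarrow> prob (T g ` A) = prob A"
  using measure_distr[OF measurable_T[of "- g"], of A]
  by (simp add: image_T_eq_vimage measure_preserving_T)

lemma event_cov_image_T_image_T:
  assumes A: "A \<in> events" and B: "B \<in> events"
  shows "event_cov (T g ` A) (T h ` B) = event_cov A (T (h - g) ` B)"
proof -
  have sub: "A \<subseteq> space M" "B \<subseteq> space M"
    using A B by (auto dest: sets.sets_into_space)
  have "T g ` T (h - g) ` B = T h ` B"
    unfolding image_image using sub action_add[of _ g "h - g"]
    by (intro image_cong) auto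
  moreover have "inj_on (T g) (space M)"
    using T_uminus_T by (metis inj_onI)
  ultimately have "T g ` A \<inter> T h ` B = T g ` (A \<inter> T (h - g) ` B)"
    using sub T_in_space by (subst inj_on_image_Int[where C = "space M"]) auto
  then show ?thesis
    using A B prob_image_T[of "A \<inter> T (h - g) ` B" g]
    by (simp add: event_cov_def prob_image_T image_T_in_events sets.Int)
qed

lemma return_set_eq_event_cov:
  assumes "A1 \<in> events"
  shows "return_set M T \<epsilon> A0 A1 = {g. \<bar>event_cov A0 (T g ` A1)\<bar> < \<epsilon>}"
  using assms by (simp add: return_set_def event_cov_def prob_image_T)

section \<open>Descent from \<open>\<Sigma>\<^sub>2\<^sub>n\<^sup>*\<close> to \<open>\<Sigma>\<^sub>n\<^sup>*\<close>\<close>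

text \<open>
  The comparison event \<open>A0\<close> enters only through its correlation with the translates of \<open>A1\<close>, and
  \<open>correlated_pair\<close> trades it for a correlation of these translates with each other. The
  covariance of two translates of \<open>A1\<close> depends only on the difference of the group elements;
  negating the sequences of the lower block turns this difference into a sum.
\<close>

lemma Sigma_star_halve:
  assumes "\<epsilon> > 0" and A0: "A0 \<in> events" and A1: "A1 \<in> events"
    and star: "Sigma_star_set (2 * n) (return_set M T (\<epsilon>\<^sup>2 / 2) A1 A1)"
  shows "Sigma_star_set n (return_set M T \<epsilon> A0 A1)"
proof (rule ccontr)
  assume "\<not> ?thesis"
  then obtain s where s: "\<And>j. j \<in> {1..n} \<Longrightarrow> filterlim (s j) cofinite sequentially"
    and disj: "return_set M T \<epsilon> A0 A1 \<inter> {\<Sum>j=1..n. s j (k j) | k :: nat \<Rightarrow> nat.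
            (\<forall>j\<in>{1..n}. 1 \<le> k j) \<and> strict_mono_on {1..n} k} = {}"
    unfolding Sigma_star_set_def Sigma_set_def by blast
  define b where "b k = (\<Sum>j=1..n. s j (k j))" for k :: "nat \<Rightarrow> nat"
  have cor: "\<epsilon> \<le> \<bar>event_cov A0 (T (b k) ` A1)\<bar>"
    if "\<And>j. j \<in> {1..n} \<Longrightarrow> 1 \<le> k j" "strict_mono_on {1..n} k" for k
  proof -
    have "b k \<notin> return_set M T \<epsilon> A0 A1"
      using disj that unfolding b_def by blast
    then show ?thesis
      by (simp add: return_set_eq_event_cov A1)
  qed
  define Q where "Q k \<longleftrightarrow>
      \<epsilon>\<^sup>2 / 2 \<le> \<bar>event_cov (T (b k) ` A1) (T (b (\<lambda>j. k (n + j))) ` A1)\<bar>" for k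
  have "Q k = Q k'" if "\<And>j. j \<in> {1..2 * n} \<Longrightarrow> k j = k' j" for k k'
  proof -
    have "b k = b k'" "b (\<lambda>j. k (n + j)) = b (\<lambda>j. k' (n + j))"
      unfolding b_def using that by (auto intro!: sum.cong)
    then show ?thesis
      by (simp add: Q_def)
  qed
  then obtain \<phi> :: "nat \<Rightarrow> nat" where \<phi>: "strict_mono \<phi>"
    and hom: "(\<forall>k. strict_mono_on {1..2 * n} k \<longrightarrow> Q (\<phi> \<circ> k)) \<or>
      (\<forall>k. strict_mono_on {1..2 * n} k \<longrightarrow> \<not> Q (\<phi> \<circ> k))"
    using Ramsey_subseq by blast
  \<comment> \<open>The second alternative is excluded by the blocks \<open>{n i + 1..n i + n}\<close>, two of which are
    correlated.\<close>
  have "\<exists>k. strict_mono_on {1..2 * n} k \<and> Q (\<phi> \<circ> k)"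
  proof -
    have \<phi>_ge: "i \<le> \<phi> i" for i
      using \<phi> by (rule strict_mono_imp_increasing)
    have "\<epsilon> \<le> \<bar>event_cov A0 (T (b (\<lambda>j. \<phi> (n * i + j))) ` A1)\<bar>" for i
    proof (rule cor)
      fix j assume "j \<in> {1..n}"
      then show "1 \<le> \<phi> (n * i + j)"
        using \<phi>_ge[of "n * i + j"] by auto
    qed (use strict_monoD[OF \<phi>] in \<open>auto intro!: strict_mono_onI\<close>)
    then obtain i i' where "i < i'" and
      pair: "\<epsilon>\<^sup>2 / 2 \<le> \<bar>event_cov (T (b (\<lambda>j. \<phi> (n * i + j))) ` A1)
        (T (b (\<lambda>j. \<phi> (n * i' + j))) ` A1)\<bar>"
      using A0 A1 \<open>\<epsilon> > 0\<close>
        correlated_pair[of A0 "\<lambda>i. T (b (\<lambda>j. \<phi> (n * i + j))) ` A1" \<epsilon>]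
      by (auto simp: image_T_in_events)
    define k where "k j = (if j \<le> n then n * i + j else n * i' + (j - n))" for j
    have "n * i + n \<le> n * i'"
      using \<open>i < i'\<close> mult_le_mono2[of "Suc i" i' n] by simp
    then have "strict_mono_on {1..2 * n} k"
      by (intro strict_mono_onI) (auto simp: k_def)
    moreover have "b (\<phi> \<circ> k) = b (\<lambda>j. \<phi> (n * i + j))"
      "b (\<lambda>j. (\<phi> \<circ> k) (n + j)) = b (\<lambda>j. \<phi> (n * i' + j))"
      unfolding b_def by (auto intro!: sum.cong simp: k_def)
    ultimately show ?thesis
      using pair unfolding Q_def by metis
  qed
  with hom have Q: "Q (\<phi> \<circ> k)" if "strict_mono_on {1..2 * n} k" for k
    using that by blast
  define s' where "s' j i = (if j \<le> n then - s j (\<phi> i) else s (j - n) (\<phi> i))" for j i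
  have b_diff: "(\<Sum>j=1..2 * n. s' j (k j)) = b (\<lambda>j. (\<phi> \<circ> k) (n + j)) - b (\<phi> \<circ> k)" for k
  proof -
    have "(\<Sum>j=1..n + n. s' j (k j)) =
        (\<Sum>j=1..n. s' j (k j)) + (\<Sum>j=n + 1..n + n. s' j (k j))"
      by (rule sum.ub_add_nat) simp
    also have "(\<Sum>j=n + 1..n + n. s' j (k j)) = (\<Sum>j=1..n. s' (j + n) (k (j + n)))"
      using sum.shift_bounds_cl_nat_ivl[of "\<lambda>j. s' j (k j)" 1 n n] by (simp add: add.commute)
    also have "\<dots> = b (\<lambda>j. (\<phi> \<circ> k) (n + j))"
      unfolding b_def by (intro sum.cong) (auto simp: s'_def add.commute)
    also have "(\<Sum>j=1..n. s' j (k j)) = - b (\<phi> \<circ> k)"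
      unfolding b_def sum_negf[symmetric] by (intro sum.cong) (auto simp: s'_def)
    finally show ?thesis
      by (simp add: mult_2)
  qed
  let ?E = "{\<Sum>j=1..2 * n. s' j (k j) | k :: nat \<Rightarrow> nat.
            (\<forall>j\<in>{1..2 * n}. 1 \<le> k j) \<and> strict_mono_on {1..2 * n} k}"
  have "filterlim (s' j) cofinite sequentially" if "j \<in> {1..2 * n}" for j
  proof (cases "j \<le> n")
    case True
    then have "filterlim (\<lambda>i. s j (\<phi> i)) cofinite sequentially"
      using that by (intro strict_mono_filterlim_sequentially_comp[OF s \<phi>]) auto
    then have "filterlim (\<lambda>i. - s j (\<phi> i)) cofinite sequentially"
      by (rule filterlim_cofinite_inj_comp) (simp add: inj_def)
    then show ?thesis
      using True by (simp add: s'_def [abs_def])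
  next
    case False
    then have "filterlim (\<lambda>i. s (j - n) (\<phi> i)) cofinite sequentially"
      using that by (intro strict_mono_filterlim_sequentially_comp[OF s \<phi>]) auto
    then show ?thesis
      using False by (simp add: s'_def [abs_def])
  qed
  then have "Sigma_set (2 * n) ?E"
    unfolding Sigma_set_def by blast
  then obtain k where "strict_mono_on {1..2 * n} k"
    and mem: "(\<Sum>j=1..2 * n. s' j (k j)) \<in> return_set M T (\<epsilon>\<^sup>2 / 2) A1 A1"
    using star unfolding Sigma_star_set_def by blast
  then have "Q (\<phi> \<circ> k)"
    using Q by blast
  then show False
    using mem unfolding b_diff
    by (simp add: Q_def return_set_eq_event_cov event_cov_image_T_image_T A1)
qed

end

theorem theorem1p6:
  fixes M :: "'x::metric_space measure"
    and T :: "'g::{ab_group_add, countable} \<Rightarrow> 'x \<Rightarrow> 'x"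
  assumes "measure_preserving_system M T"
  shows "(strongly_mixing M T \<longleftrightarrow>
            (\<forall>m\<ge>1. \<forall>\<epsilon>>0. \<forall>A0\<in>sets M. \<forall>A1\<in>sets M.
               Sigma_star_set m (return_set M T \<epsilon> A0 A1))) \<and>
         (strongly_mixing M T \<longleftrightarrow>
            (\<exists>m\<ge>1. \<forall>\<epsilon>>0. \<forall>A0\<in>sets M. \<forall>A1\<in>sets M.
               Sigma_star_set m (return_set M T \<epsilon> A0 A1)))"
proof -
  interpret measure_preserving_system M T by fact
  define P where "P m \<longleftrightarrow> (\<forall>\<epsilon>>0. \<forall>A0\<in>sets M. \<forall>A1\<in>sets M.
    Sigma_star_set m (return_set M T \<epsilon> A0 A1))" for m
  have mono: "P m" if "P n" "1 \<le> n" "n \<le> m" for n m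
    using that(1) unfolding P_def by (auto intro: Sigma_star_set_mono[OF _ that(2,3)])
  have halve: "P n" if "P (2 * n)" for n
    unfolding P_def
  proof (intro allI impI ballI)
    fix \<epsilon> :: real and A0 A1 assume "\<epsilon> > 0" "A0 \<in> sets M" "A1 \<in> sets M"
    moreover from this have "Sigma_star_set (2 * n) (return_set M T (\<epsilon>\<^sup>2 / 2) A1 A1)"
      using that unfolding P_def by simp
    ultimately show "Sigma_star_set n (return_set M T \<epsilon> A0 A1)"
      by (rule Sigma_star_halve)
  qed
  have descend: "P (2 ^ i) \<Longrightarrow> P 1" for i
    by (induction i) (auto dest: halve)
  have "P 1" if "P m" "1 \<le> m" for m
    using mono[OF that, of "2 ^ m"] descend[of m] less_exp[of m] by simp
  then have "P 1 \<longleftrightarrow> (\<forall>m\<ge>1. P m)" "P 1 \<longleftrightarrow> (\<exists>m\<ge>1. P m)"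
    using mono by blast+
  moreover have "strongly_mixing M T \<longleftrightarrow> P 1"
    unfolding P_def by (rule strongly_mixing_iff_Sigma_star_set_1)
  ultimately show ?thesis
    unfolding P_def[symmetric] by simp
qed

end
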